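(* For every dimension $d$ and every $\rho\ge 1$ there exists a function $\beta\colon (0,1]\to(0,1)$ with the following property. Let $\mathcal{F}$ be a finite family of $\rho$-fat convex sets in $\mathbb{R}^d$, let $0\le k\le d$ be an integer, and let $\alpha\in(0,1]$. If at least $\alpha\binom{|\mathcal{F}|}{k+2}$ of the $(k+2)$-element subfamilies of $\mathcal{F}$ have a $k$-transversal, then $\mathcal{F}$ has a subfamily of size at least $\beta(\alpha)|\mathcal{F}|$ which has a $k$-transversal.
   Context: A $k$-flat is a $k$-dimensional affine subspace of $\mathbb{R}^d$. A family of sets has a $k$-transversal if there is a single $k$-flat intersecting every member of the family. A family $\mathcal{F}$ of sets in $\mathbb{R}^d$ is $\rho$-fat if for every $K\in\mathcal{F}$ there exist $x_K\in\mathbb{R}^d$ and reals $0<r_K\le R_K$ with $R_K\le\rho r_K$ such that $B(x_K,r_K)\subseteq K\subseteq B(x_K,R_K)$, where $B(x,r)$ is the closed Euclidean ball of radius $r$ centered at $x$. *)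

theory Defs
  imports "HOL-Analysis.Analysis"
begin

(* No separate nonemptiness condition is needed: aff_dim {} = -1. *)
definition is_flat :: "nat \<Rightarrow> (real ^ 'n) set \<Rightarrow> bool" where
  "is_flat k L \<longleftrightarrow> affine L \<and> aff_dim L = int k"

definition has_transversal :: "nat \<Rightarrow> (real ^ 'n) set set \<Rightarrow> bool" where
  "has_transversal k \<F> \<longleftrightarrow> (\<exists>L. is_flat k L \<and> (\<forall>K\<in>\<F>. L \<inter> K \<noteq> {}))"

definition fat_family :: "real \<Rightarrow> (real ^ 'n) set set \<Rightarrow> bool" where
  "fat_family \<rho> \<F> \<longleftrightarrow>
     (\<forall>K\<in>\<F>. \<exists>x r R. 0 < r \<and> r \<le> R \<and> R \<le> \<rho> * r \<and> cball x r \<subseteq> K \<and> K \<subseteq> cball x R)"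

end

theory Submission
  imports Defs
begin

text \<open>
  Let \<open>y\<^sub>K\<close> be points of \<open>k + 2\<close> sets on a common \<open>k\<close>-flat, \<open>x\<^sub>K\<close> and \<open>r\<^sub>K\<close> the centres and inner
  radii of these sets. In an affine dependence \<open>\<Sum> c\<^sub>K y\<^sub>K = 0\<close> let \<open>m\<close> maximise \<open>\<bar>c\<^sub>K\<bar> r\<^sub>K\<close> and solve
  for \<open>y\<^sub>m\<close>. Then \<open>y\<^sub>m\<close> is an affine combination of the other \<open>y\<^sub>K\<close> with
  \<open>S = \<Sum> \<bar>c\<^sub>K\<bar> r\<^sub>K \<le> (k + 1) r\<^sub>m\<close>, and replacing \<open>y\<^sub>K\<close> by \<open>x\<^sub>K\<close> moves it by at most \<open>\<rho> S\<close>.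
  By convexity the set \<open>m\<close> contains a ball of radius \<open>S / (k + 1)\<close> close to \<open>y\<^sub>m\<close>. Moving only the centre
  \<open>x\<^sub>j\<close> with the largest \<open>\<bar>c\<^sub>j\<bar> r\<^sub>j\<close> by \<open>r\<^sub>j z\<close>, for a suitable \<open>z\<close> from a finite net that depends
  only on \<open>\<rho>\<close> and the dimension, makes the flat through the \<open>k + 1\<close> other centres hit that ball.
  So every good \<open>(k + 2)\<close>-tuple is charged to a triple of \<open>k + 1\<close> sets, one of them, and a net point,
  and a triple that receives the average number of charges gives the transversal.
\<close>

section \<open>Finite nets, and flats through few points\<close>

lemma finite_net_cball:
  fixes R \<delta> :: real
  assumes "\<delta> > 0"
  obtains Z :: "'a::euclidean_space set"
  where "finite Z" "Z \<noteq> {}" "\<And>w. norm w \<le> R \<Longrightarrow> \<exists>z\<in>Z. dist w z \<le> \<delta>"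
proof -
  have "cball (0::'a) R \<subseteq> (\<Union>z\<in>cball 0 R. ball z \<delta>)"
  proof
    fix w :: 'a assume "w \<in> cball 0 R"
    moreover have "w \<in> ball w \<delta>" using assms by simp
    ultimately show "w \<in> (\<Union>z\<in>cball 0 R. ball z \<delta>)" by blast
  qed
  then obtain Z :: "'a set" where Z: "finite Z" "cball 0 R \<subseteq> (\<Union>z\<in>Z. ball z \<delta>)"
    by (rule compactE_image[OF compact_cball open_ball])
  have "\<exists>z\<in>insert 0 Z. dist w z \<le> \<delta>" if "norm w \<le> R" for w
  proof -
    have "w \<in> cball 0 R" using that by simp
    then obtain z where "z \<in> Z" "dist z w < \<delta>" using Z by auto
    then show ?thesis by (metis dist_commute insertCI less_imp_le)
  qed
  then show thesis using that[of "insert 0 Z"] Z by auto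
qed

text \<open>Points are adjoined one by one; as long as the dimension is below
  \<open>k \<le> CARD('n)\<close>, some point lies outside.\<close>

lemma affine_subset_flat:
  fixes A :: "(real ^ 'n) set"
  assumes "affine A" "aff_dim A \<le> int k" "k \<le> CARD('n)"
  shows "\<exists>L. is_flat k L \<and> A \<subseteq> L"
  using assms
proof (induction "nat (int k - aff_dim A)" arbitrary: A)
  case 0
  then show ?case by (auto simp: is_flat_def)
next
  case (Suc e)
  have "A \<noteq> UNIV" using Suc by (auto simp: aff_dim_UNIV)
  then obtain x where "x \<notin> A" by auto
  then have d: "aff_dim (affine hull insert x A) = aff_dim A + 1"
    using Suc.prems by (simp add: aff_dim_insert hull_same)
  have "e = nat (int k - aff_dim (affine hull insert x A))" "aff_dim (affine hull insert x A) \<le> int k"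
    using Suc d by auto
  then obtain L where "is_flat k L" "affine hull insert x A \<subseteq> L"
    using Suc(1)[of "affine hull insert x A"] Suc.prems affine_affine_hull by blast
  moreover have "A \<subseteq> affine hull insert x A" by (meson hull_subset subset_insertI subset_trans)
  ultimately show ?case by blast
qed

text \<open>A transversal must have dimension exactly \<open>k\<close>, while the hull of at most
  \<open>k + 1\<close> points may be smaller, so the hull is enlarged to a
  \<open>k\<close>-flat.\<close>

lemma affine_hull_image_transversal:
  fixes p :: "'b \<Rightarrow> real ^ 'n"
  assumes "finite H" "card H \<le> k + 1" "k \<le> CARD('n)"
    and "\<And>K. K \<in> \<M> \<Longrightarrow> (affine hull (p ` H)) \<inter> K \<noteq> {}"
  shows "has_transversal k \<M>"
proof -
  have "aff_dim (p ` H) \<le> int (card (p ` H)) - 1"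
    using assms(1) by (intro aff_dim_le_card) auto
  also have "\<dots> \<le> int k" using assms(1,2) card_image_le[of H p] by linarith
  finally obtain L where "is_flat k L" "affine hull (p ` H) \<subseteq> L"
    using affine_subset_flat[of "affine hull (p ` H)" k] assms(3)
    by (auto simp: affine_affine_hull)
  then show ?thesis using assms(4) unfolding has_transversal_def by blast
qed

section \<open>Affine combinations and dependences of indexed points\<close>

lemma affine_sum_in:
  fixes p :: "'b \<Rightarrow> 'a::real_vector"
  assumes "affine V" "sum c I = 1" "\<And>i. i \<in> I \<Longrightarrow> p i \<in> V"
  shows "(\<Sum>i\<in>I. c i *\<^sub>R p i) \<in> V"
proof -
  have "I \<noteq> {}" using assms(2) by auto
  then obtain a where a: "a \<in> V" using assms(3) by blast
  have "subspace ((\<lambda>x. x - a) ` V)"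
    by (rule affine_diffs_subspace_subtract[OF assms(1) a])
  then have "(\<Sum>i\<in>I. c i *\<^sub>R (p i - a)) \<in> (\<lambda>x. x - a) ` V"
    using assms(3) by (intro subspace_sum subspace_scale) auto
  moreover have "(\<Sum>i\<in>I. c i *\<^sub>R (p i - a)) = (\<Sum>i\<in>I. c i *\<^sub>R p i) - a"
    using assms(2) by (simp add: scaleR_right_diff_distrib sum_subtractf flip: scaleR_left.sum)
  ultimately show ?thesis by auto
qed

text \<open>Different sets may be met in the same point, so coefficients are attached to indices.
  Distinct points are too many to be affinely independent; a coincidence \<open>y a = y b\<close>
  gives the coefficients 1 and -1.\<close>

lemma affine_relation_indexed:
  fixes y :: "'b \<Rightarrow> 'a::euclidean_space"
  assumes "finite I" "\<And>i. i \<in> I \<Longrightarrow> y i \<in> L" "aff_dim L + 2 \<le> int (card I)"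
  obtains c :: "'b \<Rightarrow> real"
  where "sum c I = 0" "(\<Sum>i\<in>I. c i *\<^sub>R y i) = 0" "\<exists>i\<in>I. c i \<noteq> 0"
proof (cases "inj_on y I")
  case True
  have sub: "y ` I \<subseteq> L" using assms(2) by auto
  have "affine_dependent (y ` I)"
  proof (rule ccontr)
    assume "\<not> affine_dependent (y ` I)"
    then have "aff_dim (y ` I) = int (card I) - 1"
      using True aff_dim_affine_independent[of "y ` I"] by (simp add: card_image)
    then show False using aff_dim_subset[OF sub] assms(3) by linarith
  qed
  then obtain u v where u: "sum u (y ` I) = 0" "v \<in> y ` I" "u v \<noteq> 0" "(\<Sum>w\<in>y ` I. u w *\<^sub>R w) = 0"
    using assms(1) by (auto simp: affine_dependent_explicit_finite)
  show thesis
    by (rule that[of "u \<circ> y"]) (use u True in \<open>auto simp: sum.reindex\<close>)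
next
  case False
  then obtain a b where ab: "a \<in> I" "b \<in> I" "a \<noteq> b" "y a = y b" by (auto simp: inj_on_def)
  define c :: "'b \<Rightarrow> real" where "c = (\<lambda>i. (if i = a then 1 else 0) - (if i = b then 1 else 0))"
  have "sum c I = 0" "(\<Sum>i\<in>I. c i *\<^sub>R y i) = 0"
    using assms(1) ab
    by (simp_all add: c_def sum_subtractf scaleR_left_diff_distrib if_distrib[of "\<lambda>t. t *\<^sub>R _"] sum.delta
        cong: if_cong)
  moreover have "c a \<noteq> 0" using ab by (simp add: c_def)
  ultimately show thesis using that ab by blast
qed

lemma finite_obtain_max:
  fixes f :: "'b \<Rightarrow> 'c::linorder"
  assumes "finite A" "A \<noteq> {}"
  obtains a where "a \<in> A" "\<And>b. b \<in> A \<Longrightarrow> f b \<le> f a"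
proof -
  have "Max (f ` A) \<in> f ` A" using assms by simp
  then obtain a where "a \<in> A" "f a = Max (f ` A)" by auto
  then show thesis using that assms(1) by simp
qed

lemma weighted_affine_combination:
  fixes y :: "'b \<Rightarrow> 'a::euclidean_space" and r :: "'b \<Rightarrow> real"
  assumes "finite I" "\<And>i. i \<in> I \<Longrightarrow> y i \<in> L" "aff_dim L + 2 \<le> int (card I)"
    and r: "\<And>i. i \<in> I \<Longrightarrow> r i > 0"
  obtains m and c :: "'b \<Rightarrow> real"
  where "m \<in> I" "sum c (I - {m}) = 1" "y m = (\<Sum>i\<in>I - {m}. c i *\<^sub>R y i)"
    "\<And>i. i \<in> I \<Longrightarrow> \<bar>c i\<bar> * r i \<le> r m"
proof -
  obtain c where c: "sum c I = 0" "(\<Sum>i\<in>I. c i *\<^sub>R y i) = 0" "\<exists>i\<in>I. c i \<noteq> 0"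
    by (rule affine_relation_indexed[of I y L, OF assms(1-3)])
  obtain m where m: "m \<in> I" "\<And>i. i \<in> I \<Longrightarrow> \<bar>c i\<bar> * r i \<le> \<bar>c m\<bar> * r m"
    using finite_obtain_max[of I "\<lambda>i. \<bar>c i\<bar> * r i"] c(3) assms(1) by blast
  obtain i where "i \<in> I" "c i \<noteq> 0" using c(3) by blast
  \<comment> \<open>The maximum dominates a positive term, so dividing by \<open>c m\<close> is
    possible.\<close>
  then have "\<bar>c m\<bar> * r m > 0" using m(2)[of i] r[of i] by (smt (verit) mult_pos_pos)
  then have cm: "c m \<noteq> 0" by auto
  have s: "sum c (I - {m}) = - c m" "(\<Sum>i\<in>I - {m}. c i *\<^sub>R y i) = - (c m *\<^sub>R y m)"
    using c(1,2) m(1) assms(1) by (simp_all add: sum_diff1)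
  show thesis
  proof (rule that[of m "\<lambda>i. - (c i / c m)"])
    show "(\<Sum>i\<in>I - {m}. - (c i / c m)) = 1"
      using s(1) cm by (simp add: sum_negf flip: sum_divide_distrib)
    have "(\<Sum>i\<in>I - {m}. - (c i / c m) *\<^sub>R y i) = (\<Sum>i\<in>I - {m}. (- inverse (c m)) *\<^sub>R (c i *\<^sub>R y i))"
      by (rule sum.cong) (auto simp: divide_inverse mult.commute)
    also have "\<dots> = (- inverse (c m)) *\<^sub>R (\<Sum>i\<in>I - {m}. c i *\<^sub>R y i)"
      by (simp only: scaleR_sum_right)
    also have "\<dots> = y m" using s(2) cm by simp
    finally show "y m = (\<Sum>i\<in>I - {m}. - (c i / c m) *\<^sub>R y i)" by simp
    show "\<bar>- (c i / c m)\<bar> * r i \<le> r m" if "i \<in> I" for i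
      using m(2)[OF that] cm by (simp add: field_simps)
  qed (use m in auto)
qed

section \<open>Geometry of fat convex sets\<close>

text \<open>The homothety with centre \<open>y\<close> and ratio \<open>t\<close> maps
  \<open>cball x r\<close> onto this ball, and by convexity it maps \<open>K\<close> into
  itself.\<close>

lemma cball_shrink_convex:
  fixes K :: "'a::real_normed_vector set"
  assumes "convex K" "cball x r \<subseteq> K" "y \<in> K" "0 < t" "t \<le> 1"
  shows "cball (y + t *\<^sub>R (x - y)) (t * r) \<subseteq> K"
proof
  fix w assume w: "w \<in> cball (y + t *\<^sub>R (x - y)) (t * r)"
  \<comment> \<open>\<open>v\<close> is the preimage of \<open>w\<close> under the
    homothety.\<close>
  define v where "v = y + (1 / t) *\<^sub>R (w - y)"
  have "t *\<^sub>R (x - v) = (y + t *\<^sub>R (x - y)) - w"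
    using assms(4) by (simp add: v_def algebra_simps)
  then have "t * norm (x - v) = dist (y + t *\<^sub>R (x - y)) w"
    using assms(4) by (metis abs_of_pos dist_norm norm_scaleR)
  then have "t * norm (x - v) \<le> t * r" using w by simp
  then have "v \<in> K" using assms(2,4) by (auto simp: dist_norm subset_iff)
  then have "(1 - t) *\<^sub>R y + t *\<^sub>R v \<in> K"
    using assms by (intro convexD_alt) auto
  moreover have "(1 - t) *\<^sub>R y + t *\<^sub>R v = w"
    using assms(4) by (simp add: v_def algebra_simps)
  ultimately show "w \<in> K" by simp
qed

text \<open>The sets may have very different sizes, but the weight
  \<open>\<bar>c j\<bar> * r j\<close> agrees with \<open>S\<close> up to the factor
  \<open>d + 1\<close>. In units of \<open>c j * r j\<close> the required correction has norm at
  most \<open>2 * \<rho> * (d + 1)\<close>, and an error of \<open>1 / (d + 1)\<close> is harmless;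
  hence one net serves all tuples.\<close>

lemma fat_tuple_pinned_flat:
  fixes x :: "'a::euclidean_space set \<Rightarrow> 'a" and r :: "'a set \<Rightarrow> real" and \<rho> :: real and d :: nat
  assumes fin: "finite \<G>" and card: "aff_dim L + 2 \<le> int (card \<G>)" "card \<G> \<le> d + 2"
    and meets: "\<And>K. K \<in> \<G> \<Longrightarrow> L \<inter> K \<noteq> {}"
    and conv: "\<And>K. K \<in> \<G> \<Longrightarrow> convex K"
    and r: "\<And>K. K \<in> \<G> \<Longrightarrow> r K > 0"
    and inner: "\<And>K. K \<in> \<G> \<Longrightarrow> cball (x K) (r K) \<subseteq> K"
    and outer: "\<And>K. K \<in> \<G> \<Longrightarrow> K \<subseteq> cball (x K) (\<rho> * r K)"
    and net: "\<And>w. norm w \<le> 2 * \<rho> * (d + 1) \<Longrightarrow> \<exists>z\<in>Z. dist w z \<le> 1 / (d + 1)"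
  obtains m j z where "m \<in> \<G>" "j \<in> \<G> - {m}" "z \<in> Z"
    "affine hull ((x(j := x j + r j *\<^sub>R z)) ` (\<G> - {m})) \<inter> m \<noteq> {}"
proof -
  have "\<exists>y. \<forall>K\<in>\<G>. y K \<in> L \<and> y K \<in> K" using meets by (intro bchoice) blast
  then obtain y where y: "\<And>K. K \<in> \<G> \<Longrightarrow> y K \<in> L" "\<And>K. K \<in> \<G> \<Longrightarrow> y K \<in> K" by blast
  obtain m c where m: "m \<in> \<G>" and c1: "sum c (\<G> - {m}) = 1"
    and ym: "y m = (\<Sum>K\<in>\<G> - {m}. c K *\<^sub>R y K)"
    and cr: "\<And>K. K \<in> \<G> \<Longrightarrow> \<bar>c K\<bar> * r K \<le> r m"
    using weighted_affine_combination[of \<G> y L r, OF fin y(1) card(1) r] by blast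
  define H where "H = \<G> - {m}"
  have "H \<noteq> {}"
  proof
    assume "H = {}"
    with c1 show False unfolding H_def by (metis sum.empty zero_neq_one)
  qed
  then have H: "finite H" "H \<noteq> {}" "card H \<le> d + 1" "H \<subseteq> \<G>"
    using fin m card(2) by (auto simp: H_def)
  define S where "S = (\<Sum>K\<in>H. \<bar>c K\<bar> * r K)"
  define D where "D = real d + 1"
  have D: "D > 0" by (simp add: D_def)
  obtain j where j: "j \<in> H" "\<And>K. K \<in> H \<Longrightarrow> \<bar>c K\<bar> * r K \<le> \<bar>c j\<bar> * r j"
    using finite_obtain_max[OF H(1,2), of "\<lambda>K. \<bar>c K\<bar> * r K"] by blast
  have rj: "r j > 0" using r j(1) H(4) by auto
  have \<rho>: "\<rho> \<ge> 0"
  proof -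
    have "dist (x m) (y m) \<le> \<rho> * r m" using outer[OF m] y(2)[OF m] by auto
    then have "0 \<le> \<rho> * r m" using zero_le_dist order_trans by blast
    then show ?thesis using r[OF m] by (simp add: zero_le_mult_iff)
  qed
  have bound: "(\<Sum>K\<in>H. \<bar>c K\<bar> * r K) \<le> D * B" if "\<And>K. K \<in> H \<Longrightarrow> \<bar>c K\<bar> * r K \<le> B" "B \<ge> 0" for B
  proof -
    have "(\<Sum>K\<in>H. \<bar>c K\<bar> * r K) \<le> real (card H) * B"
      using sum_bounded_above[of H "\<lambda>K. \<bar>c K\<bar> * r K" B] that by simp
    also have "\<dots> \<le> D * B" using H(3) that(2) by (intro mult_right_mono) (auto simp: D_def)
    finally show ?thesis .
  qed
  have S_m: "S \<le> D * r m" unfolding S_def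
    by (rule bound) (use cr H r[OF m] in auto)
  have S_j: "S \<le> D * (\<bar>c j\<bar> * r j)" unfolding S_def
    by (rule bound) (use j rj in auto)
  have j_S: "\<bar>c j\<bar> * r j \<le> S"
    unfolding S_def using H r j by (intro member_le_sum) (auto simp: subset_iff less_imp_le)
  have cj: "c j \<noteq> 0"
  proof
    assume "c j = 0"
    then have "\<bar>c K\<bar> * r K \<le> 0" if "K \<in> H" for K using j(2)[OF that] by simp
    then have "c K = 0" if "K \<in> H" for K using r[of K] H(4) that
      by (metis abs_le_zero_iff mult_le_0_iff not_le subsetD)
    then show False using c1 by (simp add: H_def)
  qed
  have S_pos: "S > 0" using j_S cj rj by (smt (verit) mult_pos_pos zero_less_abs_iff)
  \<comment> \<open>This ratio gives the shrunken ball the radius \<open>S / D\<close>; the bound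
    \<open>S_m\<close> is what makes it at most 1.\<close>
  define t where "t = S / (D * r m)"
  have t: "0 < t" "t \<le> 1" "t * r m = S / D"
    using S_pos D r[OF m] S_m by (auto simp: t_def)
  \<comment> \<open>\<open>x'\<close> is \<open>y m\<close> with centres in place of the points
    \<open>y K\<close>; \<open>q\<close> is the target it has to approach. Both lie within
    \<open>\<rho> * S\<close> of \<open>y m\<close>.\<close>
  define x' where "x' = (\<Sum>K\<in>H. c K *\<^sub>R x K)"
  define q where "q = y m + t *\<^sub>R (x m - y m)"
  have ball: "cball q (S / D) \<subseteq> m"
    using cball_shrink_convex[OF conv[OF m] inner[OF m] y(2)[OF m] t(1,2)] t(3) by (simp add: q_def)
  have near: "norm (x K - y K) \<le> \<rho> * r K" if "K \<in> \<G>" for K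
    using outer[OF that] y(2)[OF that] by (auto simp: dist_norm subset_iff)
  have "norm (y m - x') = norm (\<Sum>K\<in>H. c K *\<^sub>R (y K - x K))"
    by (simp add: ym x'_def H_def scaleR_right_diff_distrib sum_subtractf)
  also have "\<dots> \<le> (\<Sum>K\<in>H. \<rho> * (\<bar>c K\<bar> * r K))"
  proof (rule sum_norm_le)
    fix K assume "K \<in> H"
    then have "\<bar>c K\<bar> * norm (x K - y K) \<le> \<bar>c K\<bar> * (\<rho> * r K)"
      using near H(4) by (intro mult_left_mono) auto
    then show "norm (c K *\<^sub>R (y K - x K)) \<le> \<rho> * (\<bar>c K\<bar> * r K)"
      by (simp add: norm_minus_commute mult_ac)
  qed
  also have "\<dots> = \<rho> * S" by (simp add: S_def sum_distrib_left)
  finally have d1: "norm (y m - x') \<le> \<rho> * S" .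
  have "norm (q - y m) = t * norm (x m - y m)" using t(1) by (simp add: q_def)
  also have "\<dots> \<le> t * (\<rho> * r m)" using near[OF m] t(1) by (intro mult_left_mono) auto
  also have "\<dots> = \<rho> * (S / D)" using t(3) by (simp add: mult_ac)
  also have "\<dots> \<le> \<rho> * S"
    using S_pos \<rho> by (intro mult_left_mono) (auto simp: D_def field_simps)
  finally have d2: "norm (q - x') \<le> 2 * \<rho> * S"
    using d1 norm_triangle_ineq[of "q - y m" "y m - x'"] by simp
  \<comment> \<open>Moving the centre \<open>x j\<close> by exactly \<open>r j *\<^sub>R w\<close>
    would carry the combination \<open>x'\<close> to \<open>q\<close>. A net point \<open>z\<close>
    replaces \<open>w\<close>, at a cost of at most the ball radius \<open>S / D\<close>.\<close>
  define w where "w = (1 / (c j * r j)) *\<^sub>R (q - x')"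
  have cw: "(c j * r j) *\<^sub>R w = q - x'" using cj rj by (simp add: w_def)
  have "\<bar>c j\<bar> * r j * norm w = norm (q - x')"
    using rj by (simp flip: cw add: abs_mult)
  also have "\<dots> \<le> 2 * \<rho> * (D * (\<bar>c j\<bar> * r j))"
    using d2 S_j \<rho> mult_left_mono[of S "D * (\<bar>c j\<bar> * r j)" "2 * \<rho>"] by linarith
  also have "\<dots> = \<bar>c j\<bar> * r j * (2 * \<rho> * D)" by simp
  finally have "norm w \<le> 2 * \<rho> * D" using cj rj by (simp add: mult_le_cancel_left)
  then obtain z where z: "z \<in> Z" "dist w z \<le> 1 / D"
    using net[of w] by (auto simp: D_def algebra_simps)
  define p where "p = x' + (c j * r j) *\<^sub>R z"
  have "dist q p = norm ((c j * r j) *\<^sub>R (w - z))"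
    by (simp add: dist_norm p_def scaleR_right_diff_distrib cw algebra_simps)
  also have "\<dots> = (\<bar>c j\<bar> * r j) * dist w z" using rj by (simp add: abs_mult dist_norm)
  also have "\<dots> \<le> S * (1 / D)" using z(2) j_S S_pos by (intro mult_mono) auto
  finally have "p \<in> m" using ball by (auto simp: subset_iff)
  moreover have "p \<in> affine hull ((x(j := x j + r j *\<^sub>R z)) ` H)"
  proof -
    let ?x = "x(j := x j + r j *\<^sub>R z)"
    have "(\<Sum>K\<in>H. c K *\<^sub>R ?x K) = (\<Sum>K\<in>H. c K *\<^sub>R x K + (if K = j then (c j * r j) *\<^sub>R z else 0))"
      by (rule sum.cong) (auto simp: algebra_simps)
    also have "\<dots> = p" using H(1) j(1) by (simp add: sum.distrib p_def x'_def)
    finally have "p = (\<Sum>K\<in>H. c K *\<^sub>R ?x K)" by simp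
    moreover have "(\<Sum>K\<in>H. c K *\<^sub>R ?x K) \<in> affine hull (?x ` H)"
      by (rule affine_sum_in[OF affine_affine_hull c1[folded H_def]]) (blast intro: hull_inc)
    ultimately show ?thesis by simp
  qed
  ultimately show thesis using that m j(1) z(1) by (auto simp: H_def)
qed

section \<open>Counting tuples and binomial coefficients\<close>

text \<open>Each member of \<open>\<A>\<close> is determined by a pair of \<open>t\<close> and
  \<open>m\<close>, so it suffices to count pairs; a member may arise from several of them.\<close>

lemma card_insert_images_le:
  assumes "finite T" "\<And>t. t \<in> T \<Longrightarrow> finite (M t)"
    and "\<And>G. G \<in> \<A> \<Longrightarrow> \<exists>t\<in>T. \<exists>m\<in>M t. G = insert m (h t)"
  shows "card \<A> \<le> (\<Sum>t\<in>T. card (M t))"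
proof -
  have "\<A> \<subseteq> (\<Union>t\<in>T. (\<lambda>m. insert m (h t)) ` M t)" using assms(3) by blast
  then have "card \<A> \<le> card (\<Union>t\<in>T. (\<lambda>m. insert m (h t)) ` M t)"
    using assms(1,2) by (intro card_mono) auto
  also have "\<dots> \<le> (\<Sum>t\<in>T. card ((\<lambda>m. insert m (h t)) ` M t))"
    by (rule card_UN_le[OF assms(1)])
  also have "\<dots> \<le> (\<Sum>t\<in>T. card (M t))"
    using assms(2) by (intro sum_mono card_image_le)
  finally show ?thesis .
qed

text \<open>Up to the size of the net, the left side is \<open>n\<close> times the number of
  triples. With \<open>u = n - k - 1 \<ge> 1\<close>, absorption gives
  \<open>(k + 2) * (n choose (k + 2)) = u * (n choose (k + 1))\<close>, and
  \<open>n \<le> (k + 2) * u\<close>.\<close>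

lemma binomial_ratio_bound:
  fixes n k d :: nat
  assumes "k + 2 \<le> n" "k \<le> d"
  shows "real n * (real (n choose (k + 1)) * real (k + 1)) \<le> (real d + 2) ^ 3 * real (n choose (k + 2))"
proof -
  have "Suc (k + 1) * (n choose Suc (k + 1)) = (n - (k + 1)) * (n choose (k + 1))"
    by (metis binomial_absorb_comp binomial_absorption mult.commute)
  then have "real (Suc (k + 1)) * real (n choose Suc (k + 1)) = real (n - (k + 1)) * real (n choose (k + 1))"
    by (metis of_nat_mult)
  moreover define u where "u = real n - real k - 1"
  ultimately have e: "(real k + 2) * real (n choose (k + 2)) = u * real (n choose (k + 1))"
    using assms(1) by (simp add: of_nat_diff diff_diff_eq add_ac)
  have u: "u \<ge> 1" using assms(1) by (simp add: u_def)
  have "0 \<le> (u - 1) * (real k + 1)" using u by simp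
  then have n: "real n \<le> (real k + 2) * u" by (simp add: u_def algebra_simps)
  have "real n * (real (n choose (k + 1)) * real (k + 1)) \<le>
      ((real k + 2) * u) * (real (n choose (k + 1)) * (real k + 2))"
    using n u by (intro mult_mono) auto
  also have "\<dots> = (real k + 2) ^ 2 * (u * real (n choose (k + 1)))"
    by (simp add: power2_eq_square)
  also have "\<dots> = (real k + 2) ^ 2 * ((real k + 2) * real (n choose (k + 2)))"
    by (simp only: e)
  also have "\<dots> = (real k + 2) ^ 3 * real (n choose (k + 2))"
    by (simp add: power2_eq_square power3_eq_cube)
  also have "\<dots> \<le> (real d + 2) ^ 3 * real (n choose (k + 2))"
    using assms(2) by (intro mult_right_mono power_mono) auto
  finally show ?thesis .
qed

section \<open>Averaging over the pinned flats\<close>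

theorem theorem1p5:
  fixes \<rho> :: real
  assumes "\<rho> \<ge> 1"
  shows "\<exists>\<beta> :: real \<Rightarrow> real.
    (\<forall>\<alpha>\<in>{0<..1}. \<beta> \<alpha> \<in> {0<..<1}) \<and>
    (\<forall>(\<F> :: (real ^ 'n) set set) (k :: nat) (\<alpha> :: real).
       finite \<F> \<longrightarrow> fat_family \<rho> \<F> \<longrightarrow> (\<forall>K\<in>\<F>. convex K) \<longrightarrow>
       k \<le> CARD('n) \<longrightarrow> \<alpha> \<in> {0<..1} \<longrightarrow>
       real (card {\<G>. \<G> \<subseteq> \<F> \<and> card \<G> = k + 2 \<and> has_transversal k \<G>})
         \<ge> \<alpha> * real (card \<F> choose (k + 2)) \<longrightarrow>
       (\<exists>\<G> \<subseteq> \<F>. real (card \<G>) \<ge> \<beta> \<alpha> * real (card \<F>) \<and> has_transversal k \<G>))"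
proof -
  define d where "d = CARD('n)"
  \<comment> \<open>The net is fixed before \<open>\<F>\<close>, \<open>k\<close> and
    \<open>\<alpha>\<close>, so that \<open>\<beta>\<close> depends on \<open>\<rho>\<close> and the
    dimension only.\<close>
  obtain Z :: "(real ^ 'n) set" where Z: "finite Z" "Z \<noteq> {}"
    and net: "\<And>w. norm w \<le> 2 * \<rho> * (d + 1) \<Longrightarrow> \<exists>z\<in>Z. dist w z \<le> 1 / (d + 1)"
    using finite_net_cball[of "1 / (d + 1)" "2 * \<rho> * (d + 1)"] by auto
  define c where "c = real (card Z)"
  have c: "c \<ge> 1" using Z by (simp add: c_def Suc_le_eq card_gt_0_iff)
  \<comment> \<open>The cube comes from \<open>binomial_ratio_bound\<close>, the factor
    \<open>c\<close> from the choice of a net point in each triple.\<close>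
  define C where "C = (real d + 2) ^ 3 * c"
  have "1 < (real d + 2) ^ 3" by simp
  then have "1 * 1 < (real d + 2) ^ 3 * c" using c by (intro mult_less_le_imp_less) auto
  then have C: "C > 1" by (simp add: C_def)
  show ?thesis
  proof (intro exI[of _ "\<lambda>\<alpha>. \<alpha> / C"] conjI ballI allI impI)
    fix \<alpha> :: real assume "\<alpha> \<in> {0<..1}"
    then show "\<alpha> / C \<in> {0<..<1}" using C by (auto simp: field_simps)
  next
    fix \<F> :: "(real ^ 'n) set set" and k :: nat and \<alpha> :: real
    assume fin: "finite \<F>" and fat: "fat_family \<rho> \<F>" and conv: "\<forall>K\<in>\<F>. convex K"
      and k: "k \<le> CARD('n)" and \<alpha>: "\<alpha> \<in> {0<..1}"
      and many: "real (card {\<G>. \<G> \<subseteq> \<F> \<and> card \<G> = k + 2 \<and> has_transversal k \<G>})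
        \<ge> \<alpha> * real (card \<F> choose (k + 2))"
    define n where "n = card \<F>"
    have "\<forall>K\<in>\<F>. \<exists>x r. 0 < r \<and> cball x r \<subseteq> K \<and> K \<subseteq> cball x (\<rho> * r)"
      using fat unfolding fat_family_def by (meson order_trans subset_cball)
    then obtain x r where r: "\<And>K. K \<in> \<F> \<Longrightarrow> 0 < r K"
      and inner: "\<And>K. K \<in> \<F> \<Longrightarrow> cball (x K) (r K) \<subseteq> K"
      and outer: "\<And>K. K \<in> \<F> \<Longrightarrow> K \<subseteq> cball (x K) (\<rho> * r K)"
      by metis
    show "\<exists>\<G>\<subseteq>\<F>. real (card \<G>) \<ge> \<alpha> / C * real (card \<F>) \<and> has_transversal k \<G>"
    proof (cases "card \<F> < k + 2")
      case True
      \<comment> \<open>With at most \<open>k + 1\<close> sets, the hull of all centres already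
        meets every member.\<close>
      have "affine hull (x ` \<F>) \<inter> K \<noteq> {}" if "K \<in> \<F>" for K
      proof -
        have "x K \<in> K" using inner[OF that] r[OF that] by (auto simp: subset_iff)
        then show ?thesis using that by (auto intro: hull_inc)
      qed
      then have "has_transversal k \<F>"
        using affine_hull_image_transversal[OF fin _ k] True by auto
      moreover have "\<alpha> / C * real (card \<F>) \<le> 1 * real (card \<F>)"
        using \<alpha> C by (intro mult_right_mono) auto
      ultimately show ?thesis by auto
    next
      case False
      define \<A> where "\<A> = {\<G>. \<G> \<subseteq> \<F> \<and> card \<G> = k + 2 \<and> has_transversal k \<G>}"
      \<comment> \<open>A triple consists of \<open>k + 1\<close> sets, the one whose centre is
        moved, and the net point; \<open>A\<close> is its flat and \<open>M\<close> collects the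
        sets which that flat meets.\<close>
      define T where "T = (SIGMA H:{H. H \<subseteq> \<F> \<and> card H = k + 1}. H \<times> Z)"
      define A where "A = (\<lambda>(H, j, z). affine hull ((x(j := x j + r j *\<^sub>R z)) ` H))"
      define M where "M = (\<lambda>t. {K \<in> \<F>. A t \<inter> K \<noteq> {}})"
      have finH: "finite H" if "H \<subseteq> \<F>" for H using that fin finite_subset by blast
      have finT: "finite T" using fin Z finH by (auto simp: T_def intro!: finite_SigmaI)
      have finM: "finite (M t)" for t using fin by (simp add: M_def)
      have "card T = (\<Sum>H\<in>{H. H \<subseteq> \<F> \<and> card H = k + 1}. card (H \<times> Z))"
        unfolding T_def using fin Z finH by (intro card_SigmaI) auto
      also have "\<dots> = (n choose (k + 1)) * ((k + 1) * card Z)"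
        using fin by (simp add: n_def card_cartesian_product n_subsets)
      finally have cardT: "real (card T) = real (n choose (k + 1)) * real (k + 1) * c"
        by (simp only: c_def of_nat_mult mult.assoc)
      have nk: "k + 2 \<le> n" using False by (simp add: n_def)
      then have "real (card T) > 0" unfolding cardT using c by (intro mult_pos_pos) auto
      then have T: "T \<noteq> {}" by auto
      have "\<exists>t\<in>T. \<exists>m\<in>M t. \<G> = insert m (fst t)" if "\<G> \<in> \<A>" for \<G>
      proof -
        from that obtain L where \<G>: "\<G> \<subseteq> \<F>" "card \<G> = k + 2" and L: "is_flat k L" "\<forall>K\<in>\<G>. L \<inter> K \<noteq> {}"
          by (auto simp: \<A>_def has_transversal_def)
        have dims: "aff_dim L + 2 \<le> int (card \<G>)" "card \<G> \<le> d + 2"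
          using L(1) \<G>(2) k by (auto simp: is_flat_def d_def)
        have meets: "\<And>K. K \<in> \<G> \<Longrightarrow> L \<inter> K \<noteq> {}" using L(2) by blast
        have fat': "convex K" "0 < r K" "cball (x K) (r K) \<subseteq> K" "K \<subseteq> cball (x K) (\<rho> * r K)"
          if "K \<in> \<G>" for K
          using that \<G>(1) conv r inner outer by (simp_all add: subset_iff[of \<G>])
        obtain m j z where m: "m \<in> \<G>" "j \<in> \<G> - {m}" "z \<in> Z"
          "affine hull ((x(j := x j + r j *\<^sub>R z)) ` (\<G> - {m})) \<inter> m \<noteq> {}"
          by (rule fat_tuple_pinned_flat[OF finH[OF \<G>(1)] dims meets fat' net])
        then have "(\<G> - {m}, j, z) \<in> T" "m \<in> M (\<G> - {m}, j, z)" "\<G> = insert m (\<G> - {m})"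
          using \<G> finH[OF \<G>(1)] by (auto simp: T_def M_def A_def simp del: fun_upd_apply)
        then show ?thesis by (intro bexI[of _ "(\<G> - {m}, j, z)"] bexI[of _ m]) simp_all
      qed
      then have "card \<A> \<le> (\<Sum>t\<in>T. card (M t))"
        by (intro card_insert_images_le[where h = fst] finT finM)
      then have le: "real (card \<A>) \<le> (\<Sum>t\<in>T. real (card (M t)))"
        by (metis of_nat_le_iff of_nat_sum)
      \<comment> \<open>If every triple fell short, the charges would total less than
        \<open>\<alpha> * (n choose (k + 2))\<close>, contradicting \<open>many\<close>; strictness
        uses that \<open>T\<close> is nonempty.\<close>
      have "\<exists>t\<in>T. real (card (M t)) \<ge> \<alpha> / C * real n"
      proof (rule ccontr)
        assume "\<not> ?thesis"
        then have "(\<Sum>t\<in>T. real (card (M t))) < (\<Sum>t\<in>T. \<alpha> / C * real n)"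
          using finT T by (intro sum_strict_mono) auto
        also have "\<dots> = \<alpha> / (real d + 2) ^ 3 * (real n * (real (n choose (k + 1)) * real (k + 1)))"
          using c by (simp add: cardT C_def)
        also have "\<dots> \<le> \<alpha> / (real d + 2) ^ 3 * ((real d + 2) ^ 3 * real (n choose (k + 2)))"
          using \<alpha> binomial_ratio_bound[OF nk k] by (intro mult_left_mono) (auto simp: d_def)
        also have "\<dots> = \<alpha> * real (n choose (k + 2))"
        proof -
          have "(real d + 2) ^ 3 \<noteq> 0" by simp
          then show ?thesis by (simp only: times_divide_eq_left mult.assoc[symmetric]) simp
        qed
        also have "\<dots> \<le> real (card \<A>)" using many by (simp add: \<A>_def n_def)
        finally show False using le by simp
      qed
      then obtain t where t: "t \<in> T" "real (card (M t)) \<ge> \<alpha> / C * real n" by blast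
      obtain H j z where tH: "t = (H, j, z)" by (metis prod_cases3)
      have H: "H \<subseteq> \<F>" "card H = k + 1" using t(1) by (auto simp: T_def tH)
      have "has_transversal k (M t)"
        by (rule affine_hull_image_transversal[OF finH[OF H(1)] _ k, where p = "x(j := x j + r j *\<^sub>R z)"])
          (use H(2) in \<open>auto simp: M_def A_def tH\<close>)
      moreover have "M t \<subseteq> \<F>" by (auto simp: M_def)
      ultimately show ?thesis using t(2) by (auto simp: n_def)
    qed
  qed
qed

end
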